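(* Let $K$ be a field, let $P=K[x_1,\dots,x_n]$ be non-negatively $\mathbb{Z}$-graded by $W\in\mathrm{Mat}_{1,n}(\mathbb{Z})$, and let $\mathfrak{M}=\langle x_1,\dots,x_n\rangle$. Let $d\ge 1$, and let $I$ be a $W$-homogeneous ideal in $P$ with $I\cap P_0=\{0\}$ which is generated by $W$-homogeneous polynomials $g_1,\dots,g_r$ of $W$-degree $d$. Let $S=\{z_1,\dots,z_u\}$ be the set of all indeterminates $z_i$ of $W$-degree $d$ for which $I$ contains a $z_i$-separating polynomial. If $S\ne\emptyset$, then the following search succeeds: for $m'=m,\,m-1,\,\dots,1$, starting with $m=\min\{u,\dim_K(\mathrm{Lin}_{\mathfrak{M}}(I))\}$, go through all $m'$-element subsets $S'$ of $S$ until one is found such that the tuple $Z$ of the elements of $S'$ (in any order) is of top rank with respect to $\mathrm{Lin}_{\mathfrak{M}}(I)$ and $I$ contains a $Z$-separating tuple $F$ of $W$-homogeneous polynomials. The resulting tuple $Z$ is a best tuple of separating indeterminates for $I$ (and consists of indeterminates of $W$-degree $d$), and $F$ is a $Z$-separating tuple of $W$-homogeneous polynomials in $I$.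
   Context: Grading: $W=(w_1,\dots,w_n)$ defines the $\mathbb{Z}$-grading on $P$ with $\deg_W(x_i)=w_i$; it is non-negative if all $w_i\ge 0$. $P_0$ is the degree-$0$ component. Separating: $\mathrm{Supp}(h)$ is the set of power products occurring in $h$ with nonzero coefficient; $\mathrm{LT}_\sigma(f)$ is the leading term (power product) of $f$ with respect to a term ordering $\sigma$. A polynomial $f$ is $z$-separating for an indeterminate $z$ if $f=z-h$ with $z$ dividing no term in $\mathrm{Supp}(h)$. For a tuple $Z=(z_1,\dots,z_s)$ of distinct indeterminates, a tuple $F=(f_1,\dots,f_s)\in P^s$ is $Z$-separating if there is a term ordering $\sigma$ with $\mathrm{LT}_\sigma(f_i)=z_i$ for all $i$; it is coherently $Z$-separating if $f_i=z_i-h_i$ with $z_i$ dividing no term in $\mathrm{Supp}(h_j)$ for all $i,j$. Linear part: for $f\in\mathfrak{M}$, $\mathrm{Lin}_{\mathfrak{M}}(f)$ is the homogeneous component of $f$ of standard degree $1$; $\mathrm{Lin}_{\mathfrak{M}}(I)$ is the $K$-vector space spanned by $\mathrm{Lin}_{\mathfrak{M}}(f)$ for $f\in I$. A tuple $Z$ of $s$ distinct indeterminates is of top rank with respect to $\mathrm{Lin}_{\mathfrak{M}}(I)$ if, for linear forms $\ell_i=a_{i1}x_1+\cdots+a_{in}x_n$ ($i=1,\dots,r$) spanning $\mathrm{Lin}_{\mathfrak{M}}(I)$, the submatrix of $(a_{ij})$ consisting of the columns corresponding to the indeterminates in $Z$ has rank $s$ (independent of the choice of the spanning set). Best tuple: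 let $s\le\dim_K(\mathrm{Lin}_{\mathfrak{M}}(I))$ be the largest number such that there exist a tuple of distinct indeterminates $Z=(z_1,\dots,z_s)$ and a coherently $Z$-separating tuple of polynomials in $I$. Such a tuple $Z$ is called a best tuple of separating indeterminates for $I$. *)

theory Defs
  imports
    "HOL-Library.Poly_Mapping"
    "Jordan_Normal_Form.DL_Rank"
begin

text \<open>
  The indeterminates of \<open>P = K[x\<^sub>1, \<dots>, x\<^sub>n]\<close> are the elements of a finite type \<open>'v\<close>
  (so \<open>n = CARD('v)\<close>). A power product is its exponent vector, written additively.
\<close>

type_synonym 'v power_product = "'v \<Rightarrow>\<^sub>0 nat"
type_synonym ('v, 'k) mpoly = "'v power_product \<Rightarrow>\<^sub>0 'k"

definition pp_indet :: "'v \<Rightarrow> 'v power_product" where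
  "pp_indet z = Poly_Mapping.single z 1"

definition pp_dvd :: "'v power_product \<Rightarrow> 'v power_product \<Rightarrow> bool" where
  "pp_dvd s t \<longleftrightarrow> (\<exists>u. t = s + u)"

definition indet :: "'v \<Rightarrow> ('v, 'k::field) mpoly" where
  "indet z = Poly_Mapping.single (pp_indet z) 1"

definition poly_scale :: "'k::field \<Rightarrow> ('v, 'k) mpoly \<Rightarrow> ('v, 'k) mpoly" where
  "poly_scale c p = Poly_Mapping.single 0 c * p"

global_interpretation poly_vs: Vector_Spaces.vector_space
  "poly_scale :: 'k::field \<Rightarrow> ('v, 'k) mpoly \<Rightarrow> ('v, 'k) mpoly"
  by unfold_locales
    (simp_all add: poly_scale_def distrib_left distrib_right single_add
      mult_single flip: mult.assoc)

text \<open>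
  Every commutative ring is a module over itself: \<open>ring_mod.subspace\<close> is the notion of an ideal
  and \<open>ring_mod.span G\<close> is the ideal generated by \<open>G\<close>.
\<close>

global_interpretation ring_mod: Modules.module "(*) :: 'a::comm_ring_1 \<Rightarrow> 'a \<Rightarrow> 'a"
  by unfold_locales (simp_all add: algebra_simps)


text \<open>Gradings\<close>

definition pp_deg :: "('v::finite \<Rightarrow> int) \<Rightarrow> 'v power_product \<Rightarrow> int" where
  "pp_deg W t = (\<Sum>x\<in>UNIV. int (Poly_Mapping.lookup t x) * W x)"

definition hom_component ::
    "('v::finite \<Rightarrow> int) \<Rightarrow> int \<Rightarrow> ('v, 'k::field) mpoly \<Rightarrow> ('v, 'k) mpoly" where
  "hom_component W e f =
     (\<Sum>t\<in>{t \<in> Poly_Mapping.keys f. pp_deg W t = e}.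
        Poly_Mapping.single t (Poly_Mapping.lookup f t))"

definition hom_part :: "('v::finite \<Rightarrow> int) \<Rightarrow> int \<Rightarrow> ('v, 'k::field) mpoly set" where
  "hom_part W e = {f. \<forall>t\<in>Poly_Mapping.keys f. pp_deg W t = e}"

definition homogeneous :: "('v::finite \<Rightarrow> int) \<Rightarrow> ('v, 'k::field) mpoly \<Rightarrow> bool" where
  "homogeneous W f \<longleftrightarrow> (\<exists>e. f \<in> hom_part W e)"

definition homogeneous_ideal :: "('v::finite \<Rightarrow> int) \<Rightarrow> ('v, 'k::field) mpoly set \<Rightarrow> bool" where
  "homogeneous_ideal W I \<longleftrightarrow>
     ring_mod.subspace I \<and> (\<forall>f\<in>I. \<forall>e. hom_component W e f \<in> I)"


text \<open>Term orderings and separating tuples\<close>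

definition term_ordering :: "('v power_product \<times> 'v power_product) set \<Rightarrow> bool" where
  "term_ordering \<sigma> \<longleftrightarrow>
     linear_order \<sigma> \<and> (\<forall>t. (0, t) \<in> \<sigma>) \<and>
     (\<forall>s t u. (s, t) \<in> \<sigma> \<longrightarrow> (s + u, t + u) \<in> \<sigma>)"

text \<open>Unspecified for \<open>f = 0\<close>.\<close>

definition leading_term ::
    "('v power_product \<times> 'v power_product) set \<Rightarrow> ('v, 'k::field) mpoly \<Rightarrow> 'v power_product" where
  "leading_term \<sigma> f =
     (THE t. t \<in> Poly_Mapping.keys f \<and> (\<forall>s\<in>Poly_Mapping.keys f. (s, t) \<in> \<sigma>))"

definition separating_poly :: "'v \<Rightarrow> ('v, 'k::field) mpoly \<Rightarrow> bool" where
  "separating_poly z f \<longleftrightarrow>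
     (\<exists>h. f = indet z - h \<and> (\<forall>t\<in>Poly_Mapping.keys h. \<not> pp_dvd (pp_indet z) t))"

definition separating_tuple :: "'v list \<Rightarrow> ('v, 'k::field) mpoly list \<Rightarrow> bool" where
  "separating_tuple Z F \<longleftrightarrow>
     distinct Z \<and> length F = length Z \<and>
     (\<exists>\<sigma>. term_ordering \<sigma> \<and>
        (\<forall>i<length Z. F ! i \<noteq> 0 \<and> leading_term \<sigma> (F ! i) = pp_indet (Z ! i)))"

definition coherently_separating_tuple :: "'v list \<Rightarrow> ('v, 'k::field) mpoly list \<Rightarrow> bool" where
  "coherently_separating_tuple Z F \<longleftrightarrow>
     distinct Z \<and> length F = length Z \<and>
     (\<exists>H. length H = length Z \<and>
        (\<forall>i<length Z. F ! i = indet (Z ! i) - H ! i) \<and>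
        (\<forall>i<length Z. \<forall>j<length Z. \<forall>t\<in>Poly_Mapping.keys (H ! j).
           \<not> pp_dvd (pp_indet (Z ! i)) t))"


text \<open>Linear parts\<close>

definition lin_part :: "('v::finite, 'k::field) mpoly \<Rightarrow> ('v, 'k) mpoly" where
  "lin_part f = hom_component (\<lambda>_. 1) 1 f"

definition lin_space :: "('v::finite, 'k::field) mpoly set \<Rightarrow> ('v, 'k) mpoly set" where
  "lin_space I = poly_vs.span (lin_part ` I)"

definition coeff_columns :: "('v, 'k::field) mpoly list \<Rightarrow> 'v list \<Rightarrow> 'k mat" where
  "coeff_columns ls Z =
     mat (length ls) (length Z) (\<lambda>(i, j). Poly_Mapping.lookup (ls ! i) (pp_indet (Z ! j)))"

text \<open>
  The rank does not depend on the finite spanning family \<open>ls\<close>; such families exist by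
  \<open>lin_space_spanning_list\<close> below, so the quantification is never vacuous.
\<close>

definition top_rank :: "('v::finite, 'k::field) mpoly set \<Rightarrow> 'v list \<Rightarrow> bool" where
  "top_rank I Z \<longleftrightarrow>
     (\<forall>ls. poly_vs.span (set ls) = lin_space I \<longrightarrow>
        vec_space.rank (length ls) (coeff_columns ls Z) = length Z)"

lemma pp_deg_one_eq_1:
  fixes t :: "'v::finite power_product"
  assumes "pp_deg (\<lambda>_. 1) t = 1"
  shows "\<exists>x. t = pp_indet x"
proof -
  have "int (\<Sum>x\<in>UNIV. Poly_Mapping.lookup t x) = 1"
    using assms by (simp add: pp_deg_def)
  hence "(\<Sum>x\<in>UNIV. Poly_Mapping.lookup t x) = 1" by linarith
  then obtain x where x: "Poly_Mapping.lookup t x = 1"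
      "\<forall>y\<in>UNIV. x \<noteq> y \<longrightarrow> Poly_Mapping.lookup t y = 0"
    using sum_eq_1_iff[OF finite_UNIV, of "Poly_Mapping.lookup t"] by blast
  have "t = pp_indet x"
    by (rule poly_mapping_eqI) (use x in \<open>auto simp: pp_indet_def lookup_single when_def\<close>)
  thus ?thesis ..
qed

lemma lin_space_spanning_list:
  fixes I :: "('v::finite, 'k::field) mpoly set"
  shows "\<exists>ls. poly_vs.span (set ls) = lin_space I"
proof -
  let ?X = "indet ` (UNIV :: 'v set) :: ('v, 'k) mpoly set"
  have "lin_part f \<in> poly_vs.span ?X" for f :: "('v, 'k) mpoly"
    unfolding lin_part_def hom_component_def
  proof (rule poly_vs.span_sum)
    fix t assume "t \<in> {t \<in> Poly_Mapping.keys f. pp_deg (\<lambda>_. 1) t = 1}"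
    then obtain x where t: "t = pp_indet x" using pp_deg_one_eq_1 by blast
    have "Poly_Mapping.single t (Poly_Mapping.lookup f t)
        = poly_scale (Poly_Mapping.lookup f t) (indet x)"
      by (simp add: t poly_scale_def indet_def mult_single)
    thus "Poly_Mapping.single t (Poly_Mapping.lookup f t) \<in> poly_vs.span ?X"
      by (simp add: poly_vs.span_base poly_vs.span_scale)
  qed
  hence sub: "lin_part ` I \<subseteq> poly_vs.span ?X" by blast
  obtain B where B: "B \<subseteq> lin_part ` I" "poly_vs.independent B"
      "lin_part ` I \<subseteq> poly_vs.span B"
    using poly_vs.maximal_independent_subset by blast
  have "finite B"
    using poly_vs.independent_span_bound[of ?X B] B sub by auto
  then obtain ls where "set ls = B" using finite_list by blast
  moreover have "poly_vs.span B = lin_space I"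
    unfolding lin_space_def
    using B by (metis poly_vs.span_mono poly_vs.span_minimal poly_vs.subspace_span subset_antisym)
  ultimately show ?thesis by blast
qed


text \<open>Best tuples\<close>

definition admits_coherent :: "('v::finite, 'k::field) mpoly set \<Rightarrow> 'v list \<Rightarrow> bool" where
  "admits_coherent I Z \<longleftrightarrow>
     distinct Z \<and> (\<exists>F. set F \<subseteq> I \<and> coherently_separating_tuple Z F)"

definition best_tuple :: "('v::finite, 'k::field) mpoly set \<Rightarrow> 'v list \<Rightarrow> bool" where
  "best_tuple I Z \<longleftrightarrow>
     admits_coherent I Z \<and>
     length Z = (GREATEST s. s \<le> poly_vs.dim (lin_space I) \<and>
                   (\<exists>Z'. length Z' = s \<and> admits_coherent I Z'))"


text \<open>The search\<close>

definition separating_indets ::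
    "('v::finite \<Rightarrow> int) \<Rightarrow> int \<Rightarrow> ('v, 'k::field) mpoly set \<Rightarrow> 'v set" where
  "separating_indets W d I = {z. pp_deg W (pp_indet z) = d \<and> (\<exists>f\<in>I. separating_poly z f)}"

definition homogeneous_separating_in ::
    "('v::finite \<Rightarrow> int) \<Rightarrow> ('v, 'k::field) mpoly set \<Rightarrow> 'v list \<Rightarrow> ('v, 'k) mpoly list \<Rightarrow> bool" where
  "homogeneous_separating_in W I Z F \<longleftrightarrow>
     set F \<subseteq> I \<and> (\<forall>f\<in>set F. homogeneous W f) \<and> separating_tuple Z F"

definition accepts ::
    "('v::finite \<Rightarrow> int) \<Rightarrow> ('v, 'k::field) mpoly set \<Rightarrow> 'v list \<Rightarrow> bool" where
  "accepts W I Z \<longleftrightarrow> top_rank I Z \<and> (\<exists>F. homogeneous_separating_in W I Z F)"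

text \<open>
  \<open>cand k\<close> lists, in an arbitrary order, all \<open>k\<close>-element subsets of \<open>S\<close>, each written as a tuple
  of its elements in an arbitrary order.
\<close>

definition enumerates_subsets :: "'v set \<Rightarrow> (nat \<Rightarrow> 'v list list) \<Rightarrow> bool" where
  "enumerates_subsets S cand \<longleftrightarrow>
     (\<forall>k. (\<forall>Z\<in>set (cand k). distinct Z) \<and>
          set ` set (cand k) = {S'. S' \<subseteq> S \<and> card S' = k})"

text \<open>The outer loop runs through the sizes \<open>m, m - 1, \<dots>, 1\<close>.\<close>

definition top_down_search ::
    "('v list \<Rightarrow> bool) \<Rightarrow> (nat \<Rightarrow> 'v list list) \<Rightarrow> nat \<Rightarrow> 'v list option" where
  "top_down_search acc cand m = find acc (concat (map cand (rev [1..<Suc m])))"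

end

theory Submission
  imports Defs
begin

text \<open>
  A tuple is accepted by the search if and only if it admits a coherently separating tuple in \<open>I\<close>:
  one direction is interreduction; for the other, the linear parts of a coherently separating tuple
  restrict to the identity matrix on the columns of \<open>Z\<close>, and its \<open>W\<close>-homogeneous components of the
  appropriate degrees are separating for an elimination ordering. The indeterminates of such a tuple
  have \<open>W\<close>-degree \<open>d\<close>, since the coefficients of \<open>1\<close> and of every \<open>x\<close> with \<open>W x \<noteq> d\<close> vanish on
  the generators, and this property passes to the ideal. So every competitor for a best tuple of
  size at least \<open>1\<close> is, up to order, a candidate in the search.
\<close>

section \<open>Power products, indeterminates and homogeneous components\<close>

lemma lookup_pp_indet: "Poly_Mapping.lookup (pp_indet x) y = (if x = y then 1 else 0)"
  by (simp add: pp_indet_def lookup_single when_def)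

lemma pp_indet_eq_iff [simp]: "pp_indet x = pp_indet y \<longleftrightarrow> x = y"
  by (metis lookup_pp_indet one_neq_zero)

lemma pp_dvd_pp_indet_iff: "pp_dvd (pp_indet x) t \<longleftrightarrow> Poly_Mapping.lookup t x \<noteq> 0"
proof
  assume "pp_dvd (pp_indet x) t"
  then show "Poly_Mapping.lookup t x \<noteq> 0"
    by (auto simp: pp_dvd_def lookup_add lookup_pp_indet)
next
  assume "Poly_Mapping.lookup t x \<noteq> 0"
  then have "t = pp_indet x + (t - pp_indet x)"
    by (intro poly_mapping_eqI) (auto simp: lookup_add lookup_minus lookup_pp_indet)
  then show "pp_dvd (pp_indet x) t"
    unfolding pp_dvd_def by blast
qed

lemma pp_deg_0 [simp]: "pp_deg W 0 = 0"
  by (simp add: pp_deg_def)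

lemma pp_deg_pp_indet [simp]: "pp_deg W (pp_indet x) = W x"
proof -
  have "pp_deg W (pp_indet x) = (\<Sum>y\<in>UNIV. if x = y then W y else 0)"
    unfolding pp_deg_def by (intro sum.cong) (auto simp: lookup_pp_indet)
  then show ?thesis by simp
qed

text \<open>Irreducibility of an indeterminate in the monoid of power products. It limits how a
  linear term can arise in a product of polynomials.\<close>

lemma add_eq_pp_indetE:
  assumes "s + t = pp_indet x"
  obtains "s = 0" "t = pp_indet x" | "s = pp_indet x" "t = 0"
proof -
  have l: "Poly_Mapping.lookup s y + Poly_Mapping.lookup t y = (if x = y then 1 else 0)" for y
    using assms by (metis lookup_add lookup_pp_indet)
  show ?thesis
  proof (cases "Poly_Mapping.lookup s x = 0")
    case True
    have "s = 0"
    proof (rule poly_mapping_eqI)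
      fix y show "Poly_Mapping.lookup s y = Poly_Mapping.lookup 0 y"
        using l[of y] True by (cases "x = y") auto
    qed
    with assms that show ?thesis by simp
  next
    case False
    have "t = 0"
    proof (rule poly_mapping_eqI)
      fix y show "Poly_Mapping.lookup t y = Poly_Mapping.lookup 0 y"
        using l[of y] False by (cases "x = y") auto
    qed
    with assms that show ?thesis by simp
  qed
qed

lemma keys_indet [simp]: "Poly_Mapping.keys (indet x :: ('v, 'k::field) mpoly) = {pp_indet x}"
  by (simp add: indet_def)

lemma lookup_indet:
  "Poly_Mapping.lookup (indet x :: ('v, 'k::field) mpoly) t = (if t = pp_indet x then 1 else 0)"
  by (auto simp: indet_def lookup_single when_def)

lemma poly_mapping_eq_sum_single:
  "p = (\<Sum>t\<in>Poly_Mapping.keys p. Poly_Mapping.single t (Poly_Mapping.lookup p t))"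
proof (rule poly_mapping_eqI)
  fix s
  have "(\<Sum>t\<in>Poly_Mapping.keys p. Poly_Mapping.lookup (Poly_Mapping.single t (Poly_Mapping.lookup p t)) s)
      = (\<Sum>t\<in>Poly_Mapping.keys p. if s = t then Poly_Mapping.lookup p t else 0)"
    by (intro sum.cong) (auto simp: lookup_single when_def)
  then show "Poly_Mapping.lookup p s = Poly_Mapping.lookup
      (\<Sum>t\<in>Poly_Mapping.keys p. Poly_Mapping.single t (Poly_Mapping.lookup p t)) s"
    by (simp add: lookup_sum in_keys_iff)
qed

lemma lookup_hom_component:
  "Poly_Mapping.lookup (hom_component W e f) t =
     (if pp_deg W t = e then Poly_Mapping.lookup f t else 0)"
proof -
  have "Poly_Mapping.lookup (hom_component W e f) t =
      (\<Sum>s\<in>{s \<in> Poly_Mapping.keys f. pp_deg W s = e}. if t = s then Poly_Mapping.lookup f s else 0)"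
    unfolding hom_component_def lookup_sum
    by (intro sum.cong) (auto simp: lookup_single when_def)
  then show ?thesis by (auto simp: in_keys_iff)
qed

lemma hom_component_in_hom_part: "hom_component W e f \<in> hom_part W e"
  by (auto simp: hom_part_def in_keys_iff lookup_hom_component split: if_splits)

lemma hom_component_indet_diff:
  fixes h :: "('v::finite, 'k::field) mpoly"
  shows "hom_component W (W z) (indet z - h) = indet z - hom_component W (W z) h"
  by (rule poly_mapping_eqI) (auto simp: lookup_hom_component lookup_minus lookup_indet)

section \<open>Polynomials avoiding a set of indeterminates, and coherence\<close>

text \<open>This is membership in the subring generated over \<open>K\<close> by the indeterminates
  outside \<open>V\<close>. Taking a set \<open>V\<close> instead of one indeterminate turns
  coherence into a closure property that sums, products and homogeneous components preserve.\<close>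

definition avoids :: "'v set \<Rightarrow> ('v, 'k::field) mpoly \<Rightarrow> bool" where
  "avoids V p \<longleftrightarrow> (\<forall>t\<in>Poly_Mapping.keys p. \<forall>y\<in>V. Poly_Mapping.lookup t y = 0)"

lemma avoids_add: "avoids V p \<Longrightarrow> avoids V q \<Longrightarrow> avoids V (p + q)"
  using keys_add[of p q] unfolding avoids_def by blast

lemma avoids_uminus: "avoids V p \<Longrightarrow> avoids V (- p)"
  by (simp add: avoids_def)

lemma avoids_mult: "avoids V p \<Longrightarrow> avoids V q \<Longrightarrow> avoids V (p * q)"
  using keys_mult[of p q] by (fastforce simp: avoids_def lookup_add)

lemma avoids_single_0: "avoids V (Poly_Mapping.single 0 c)"
  by (simp add: avoids_def)

lemma avoids_indet: "y \<notin> V \<Longrightarrow> avoids V (indet y)"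
  by (auto simp: avoids_def lookup_pp_indet)

lemma avoids_hom_component: "avoids V p \<Longrightarrow> avoids V (hom_component W e p)"
  by (auto simp: avoids_def in_keys_iff lookup_hom_component split: if_splits)

lemma avoids_lookup_pp_indet: "avoids V p \<Longrightarrow> y \<in> V \<Longrightarrow> Poly_Mapping.lookup p (pp_indet y) = 0"
  unfolding avoids_def by (metis in_keys_iff lookup_pp_indet one_neq_zero)

lemma separating_poly_iff_avoids:
  "separating_poly z f \<longleftrightarrow> (\<exists>h. f = indet z - h \<and> avoids {z} h)"
  by (simp add: separating_poly_def avoids_def pp_dvd_pp_indet_iff)

text \<open>Coherence constrains each \<open>h\<close> only through the set of entries of
  \<open>Z\<close>, so the witnesses for different entries can be chosen independently. This removes
  the lists \<open>F\<close> and \<open>H\<close> and shows that the order of \<open>Z\<close> is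
  irrelevant.\<close>

lemma admits_coherent_iff:
  fixes I :: "('v::finite, 'k::field) mpoly set"
  shows "admits_coherent I Z \<longleftrightarrow>
    distinct Z \<and> (\<forall>z\<in>set Z. \<exists>h. indet z - h \<in> I \<and> avoids (set Z) h)"
proof
  assume "admits_coherent I Z"
  then obtain F H where *: "distinct Z" "set F \<subseteq> I" "length F = length Z" "length H = length Z"
    "\<And>i. i < length Z \<Longrightarrow> F ! i = indet (Z ! i) - H ! i"
    "\<And>i j t. i < length Z \<Longrightarrow> j < length Z \<Longrightarrow> t \<in> Poly_Mapping.keys (H ! j) \<Longrightarrow>
       \<not> pp_dvd (pp_indet (Z ! i)) t"
    unfolding admits_coherent_def coherently_separating_tuple_def by blast
  have "\<exists>h. indet z - h \<in> I \<and> avoids (set Z) h" if z: "z \<in> set Z" for z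
  proof -
    obtain j where j: "j < length Z" "z = Z ! j"
      using z by (metis in_set_conv_nth)
    have "indet z - H ! j \<in> I"
      using * j by (metis nth_mem subsetD)
    moreover have "avoids (set Z) (H ! j)"
      using *(6) j(1) unfolding avoids_def pp_dvd_pp_indet_iff by (metis in_set_conv_nth)
    ultimately show ?thesis by blast
  qed
  with *(1) show "distinct Z \<and> (\<forall>z\<in>set Z. \<exists>h. indet z - h \<in> I \<and> avoids (set Z) h)" by blast
next
  assume *: "distinct Z \<and> (\<forall>z\<in>set Z. \<exists>h. indet z - h \<in> I \<and> avoids (set Z) h)"
  then obtain h where h: "\<And>z. z \<in> set Z \<Longrightarrow> indet z - h z \<in> I \<and> avoids (set Z) (h z)"
    by metis
  have "coherently_separating_tuple Z (map (\<lambda>z. indet z - h z) Z)"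
    unfolding coherently_separating_tuple_def pp_dvd_pp_indet_iff
    using * h by (intro conjI exI[of _ "map h Z"]) (auto simp: avoids_def dest: nth_mem)
  moreover have "set (map (\<lambda>z. indet z - h z) Z) \<subseteq> I"
    using h by auto
  ultimately show "admits_coherent I Z"
    using * unfolding admits_coherent_def by blast
qed

lemma admits_coherent_cong_set:
  assumes "admits_coherent I Z" "distinct Z'" "set Z' = set Z"
  shows "admits_coherent I Z'"
  using assms by (simp add: admits_coherent_iff)

section \<open>Lexicographic and elimination orderings, leading terms\<close>

text \<open>The lexicographic ordering in which a smaller rank \<open>r\<close> means a larger
  indeterminate. Two distinct exponent vectors are compared at the position of least rank where they
  differ; injectivity of \<open>r\<close> makes this position unique.\<close>

lemma lex_term_ordering:
  fixes r :: "'v::finite \<Rightarrow> nat"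
  assumes "inj r"
  defines "\<sigma> \<equiv> {(s, t). s = t \<or> (\<exists>x. Poly_Mapping.lookup s x < Poly_Mapping.lookup t x \<and>
     (\<forall>y. r y < r x \<longrightarrow> Poly_Mapping.lookup s y = Poly_Mapping.lookup t y))}"
  shows "term_ordering \<sigma>"
proof -
  have least: "\<exists>x. Poly_Mapping.lookup s x \<noteq> Poly_Mapping.lookup t x \<and>
      (\<forall>y. r y < r x \<longrightarrow> Poly_Mapping.lookup s y = Poly_Mapping.lookup t y)"
    if "s \<noteq> t" for s t :: "'v power_product"
  proof -
    let ?P = "\<lambda>x. Poly_Mapping.lookup s x \<noteq> Poly_Mapping.lookup t x"
    have "\<exists>x. ?P x"
    proof (rule ccontr)
      assume "\<nexists>x. ?P x"
      then have "s = t" by (intro poly_mapping_eqI) simp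
      with that show False ..
    qed
    then obtain x where "?P x" ..
    from ex_has_least_nat[of ?P, OF this, of r]
    obtain x where "?P x" "\<forall>y. ?P y \<longrightarrow> r x \<le> r y" by blast
    then show ?thesis by (intro exI[of _ x]) (simp add: linorder_not_less[symmetric], blast)
  qed
  have "antisym \<sigma>"
  proof (rule antisymI)
    fix s t assume st: "(s, t) \<in> \<sigma>" and ts: "(t, s) \<in> \<sigma>"
    show "s = t"
    proof (rule ccontr)
      assume "s \<noteq> t"
      with st ts obtain x y where
        x: "Poly_Mapping.lookup s x < Poly_Mapping.lookup t x"
           "\<And>w. r w < r x \<Longrightarrow> Poly_Mapping.lookup s w = Poly_Mapping.lookup t w" and
        y: "Poly_Mapping.lookup t y < Poly_Mapping.lookup s y"
           "\<And>w. r w < r y \<Longrightarrow> Poly_Mapping.lookup t w = Poly_Mapping.lookup s w"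
        unfolding \<sigma>_def by blast
      then have "\<not> r x < r y" "\<not> r y < r x" by force+
      then have "x = y" using assms(1) by (simp add: inj_eq)
      with x y show False by simp
    qed
  qed
  moreover have "trans \<sigma>"
  proof (rule transI)
    fix s t u assume st: "(s, t) \<in> \<sigma>" and tu: "(t, u) \<in> \<sigma>"
    show "(s, u) \<in> \<sigma>"
    proof (cases "s = t \<or> t = u")
      case True
      with st tu show ?thesis by auto
    next
      case False
      with st tu obtain x y where
        x: "Poly_Mapping.lookup s x < Poly_Mapping.lookup t x"
           "\<And>w. r w < r x \<Longrightarrow> Poly_Mapping.lookup s w = Poly_Mapping.lookup t w" and
        y: "Poly_Mapping.lookup t y < Poly_Mapping.lookup u y"
           "\<And>w. r w < r y \<Longrightarrow> Poly_Mapping.lookup t w = Poly_Mapping.lookup u w"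
        unfolding \<sigma>_def by blast
      \<comment> \<open>The position of smaller rank decides between \<open>s\<close> and
        \<open>u\<close>: at all positions of still smaller rank the three exponent vectors
        agree.\<close>
      consider "r x < r y" | "x = y" | "r y < r x"
        using inj_eq[OF assms(1), of x y] by linarith
      then have "\<exists>v. Poly_Mapping.lookup s v < Poly_Mapping.lookup u v \<and>
          (\<forall>w. r w < r v \<longrightarrow> Poly_Mapping.lookup s w = Poly_Mapping.lookup u w)"
      proof cases
        case 1
        with x y show ?thesis by (intro exI[of _ x]) auto
      next
        case 2
        with x y show ?thesis by (intro exI[of _ x]) auto
      next
        case 3
        with x y show ?thesis by (intro exI[of _ y]) auto
      qed
      then show ?thesis unfolding \<sigma>_def by blast
    qed
  qed
  moreover have "(s, t) \<in> \<sigma> \<or> (t, s) \<in> \<sigma>" for s t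
  proof (cases "s = t")
    case True
    then show ?thesis by (simp add: \<sigma>_def)
  next
    case False
    then obtain x where x: "Poly_Mapping.lookup s x \<noteq> Poly_Mapping.lookup t x"
        "\<forall>y. r y < r x \<longrightarrow> Poly_Mapping.lookup s y = Poly_Mapping.lookup t y"
      using least by blast
    then consider "Poly_Mapping.lookup s x < Poly_Mapping.lookup t x"
      | "Poly_Mapping.lookup t x < Poly_Mapping.lookup s x" by linarith
    then show ?thesis using x(2) unfolding \<sigma>_def by cases force+
  qed
  moreover have "refl \<sigma>"
    by (simp add: refl_on_def \<sigma>_def)
  moreover have "(0, t) \<in> \<sigma>" for t
    using least[of 0 t] unfolding \<sigma>_def by auto
  moreover have "(s + u, t + u) \<in> \<sigma>" if "(s, t) \<in> \<sigma>" for s t u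
    using that unfolding \<sigma>_def by (auto simp: lookup_add)
  ultimately show ?thesis
    by (simp add: term_ordering_def linear_order_on_def partial_order_on_def preorder_on_def
        total_on_def)
qed

text \<open>In a lexicographic ordering with the indeterminates of \<open>V\<close> first, a term
  free of \<open>V\<close> has exponent 0 at \<open>z\<close> and at every position before
  \<open>z\<close>, so it lies below \<open>z\<close>.\<close>

lemma elimination_term_ordering:
  fixes V :: "'v::finite set"
  obtains \<sigma> where "term_ordering \<sigma>"
    and "\<And>z t. z \<in> V \<Longrightarrow> \<forall>y\<in>V. Poly_Mapping.lookup t y = 0 \<Longrightarrow> (t, pp_indet z) \<in> \<sigma>"
proof -
  obtain f :: "'v \<Rightarrow> nat" and n where f: "f ` UNIV = {i. i < n}" "inj f"
    using finite_imp_inj_to_nat_seg[OF finite_UNIV] by metis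
  \<comment> \<open>Since \<open>f\<close> takes values below \<open>n\<close>, the shift by
    \<open>n\<close> ranks everything outside \<open>V\<close> behind all of \<open>V\<close> and
    keeps the ranks distinct.\<close>
  define r where "r x = (if x \<in> V then f x else f x + n)" for x
  have fn: "f x < n" for x using f(1) by auto
  have "inj r"
  proof (rule injI)
    fix x y assume "r x = r y"
    with fn[of x] fn[of y] have "f x = f y"
      by (auto simp: r_def split: if_splits)
    with f(2) show "x = y" by (simp add: injD)
  qed
  have first: "y \<in> V" if "r y < r z" "z \<in> V" for y z
    using that fn[of z] by (auto simp: r_def split: if_splits)
  show ?thesis
  proof (rule that[OF lex_term_ordering[OF \<open>inj r\<close>]])
    fix z and t :: "'v power_product"
    assume "z \<in> V" "\<forall>y\<in>V. Poly_Mapping.lookup t y = 0"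
    then have "Poly_Mapping.lookup t z < Poly_Mapping.lookup (pp_indet z) z \<and>
        (\<forall>y. r y < r z \<longrightarrow> Poly_Mapping.lookup t y = Poly_Mapping.lookup (pp_indet z) y)"
      using first by (auto simp: lookup_pp_indet)
    then show "(t, pp_indet z) \<in> {(s, t). s = t \<or>
        (\<exists>x. Poly_Mapping.lookup s x < Poly_Mapping.lookup t x \<and>
          (\<forall>y. r y < r x \<longrightarrow> Poly_Mapping.lookup s y = Poly_Mapping.lookup t y))}"
      by blast
  qed
qed

lemma leading_term_eqI:
  assumes "term_ordering \<sigma>" "t \<in> Poly_Mapping.keys f" "\<And>s. s \<in> Poly_Mapping.keys f \<Longrightarrow> (s, t) \<in> \<sigma>"
  shows "leading_term \<sigma> f = t"
proof -
  have "antisym \<sigma>"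
    using assms(1) by (simp add: term_ordering_def linear_order_on_def partial_order_on_def)
  then show ?thesis
    unfolding leading_term_def using assms by (intro the_equality) (auto dest: antisymD)
qed

lemma linear_order_finite_max:
  assumes "linear_order \<sigma>" "finite A" "A \<noteq> {}"
  shows "\<exists>t\<in>A. \<forall>s\<in>A. (s, t) \<in> \<sigma>"
  using assms(2,3)
proof (induction rule: finite_ne_induct)
  case (singleton x)
  then show ?case
    using assms(1) by (simp add: order_on_defs refl_on_def)
next
  case (insert x A)
  then obtain t where t: "t \<in> A" "\<forall>s\<in>A. (s, t) \<in> \<sigma>" by blast
  have "refl \<sigma>" "total \<sigma>" and tr: "trans \<sigma>"
    using assms(1) by (simp_all add: order_on_defs)
  then have refl: "(x, x) \<in> \<sigma>" and tot: "(x, t) \<in> \<sigma> \<or> (t, x) \<in> \<sigma>"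
    unfolding refl_on_def total_on_def by (metis UNIV_I)+
  show ?case
  proof (cases "(x, t) \<in> \<sigma>")
    case True
    with t show ?thesis by blast
  next
    case False
    with tot have "(t, x) \<in> \<sigma>" by blast
    then have "(s, x) \<in> \<sigma>" if "s \<in> A" for s
      using t(2) that tr by (blast dest: transD)
    with refl show ?thesis by blast
  qed
qed

lemma leading_term_props:
  assumes "term_ordering \<sigma>" "f \<noteq> 0"
  shows "leading_term \<sigma> f \<in> Poly_Mapping.keys f"
    and "s \<in> Poly_Mapping.keys f \<Longrightarrow> (s, leading_term \<sigma> f) \<in> \<sigma>"
proof -
  have "linear_order \<sigma>" using assms(1) by (simp add: term_ordering_def)
  moreover have "Poly_Mapping.keys f \<noteq> {}" using assms(2) by simp
  ultimately obtain t where t: "t \<in> Poly_Mapping.keys f" "\<forall>s\<in>Poly_Mapping.keys f. (s, t) \<in> \<sigma>"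
    using linear_order_finite_max[OF _ finite_keys] by blast
  with leading_term_eqI[OF assms(1)] have "leading_term \<sigma> f = t" by blast
  with t show "leading_term \<sigma> f \<in> Poly_Mapping.keys f"
    and "s \<in> Poly_Mapping.keys f \<Longrightarrow> (s, leading_term \<sigma> f) \<in> \<sigma>" by auto
qed

section \<open>Interreduction of separating tuples\<close>

text \<open>Induction on the total degree of \<open>t\<close>: after one indeterminate is split off,
  the remaining power product involves only indeterminates of \<open>t\<close>.\<close>

lemma subalgebra_single:
  fixes A :: "('v::finite, 'k::field) mpoly set"
  assumes const: "\<And>c. Poly_Mapping.single 0 c \<in> A"
    and mult: "\<And>p q. p \<in> A \<Longrightarrow> q \<in> A \<Longrightarrow> p * q \<in> A"
    and "\<And>y. Poly_Mapping.lookup t y \<noteq> 0 \<Longrightarrow> indet y \<in> A"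
  shows "Poly_Mapping.single t c \<in> A"
  using assms(3)
proof (induction "\<Sum>x\<in>UNIV. Poly_Mapping.lookup t x" arbitrary: t rule: less_induct)
  case less
  show ?case
  proof (cases "t = 0")
    case True
    then show ?thesis by (simp add: const)
  next
    case False
    then obtain y where y: "Poly_Mapping.lookup t y \<noteq> 0"
      by (metis poly_mapping_eqI lookup_zero)
    then obtain u where u: "t = pp_indet y + u"
      by (metis pp_dvd_pp_indet_iff pp_dvd_def)
    have "(\<Sum>x\<in>UNIV. Poly_Mapping.lookup u x) < (\<Sum>x\<in>UNIV. Poly_Mapping.lookup t x)"
      by (intro sum_strict_mono_ex1) (auto simp: u lookup_add lookup_pp_indet)
    then have "Poly_Mapping.single u c \<in> A"
      using less.prems by (intro less.hyps) (auto simp: u lookup_add)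
    moreover have "Poly_Mapping.single t c = indet y * Poly_Mapping.single u c"
      by (simp add: u indet_def mult_single)
    ultimately show ?thesis using mult less.prems y by simp
  qed
qed

text \<open>
  The polynomials congruent modulo \<open>I\<close> to one that avoids \<open>Z\<close> form a subalgebra. If \<open>f\<close> has leading
  term \<open>z\<close>, its other terms involve only those indeterminates of \<open>Z\<close> that are smaller than \<open>z\<close>, so
  the elements of \<open>Z\<close> enter this subalgebra one by one along \<open>\<sigma>\<close>. Working along the finite set \<open>Z\<close>
  makes Dickson's lemma unnecessary.
\<close>

lemma separating_imp_admits_coherent:
  fixes I :: "('v::finite, 'k::field) mpoly set"
  assumes I: "ring_mod.subspace I" and "set F \<subseteq> I" and sep: "separating_tuple Z F"
  shows "admits_coherent I Z"
proof -
  from sep obtain \<sigma> where Z: "distinct Z" "length F = length Z" and \<sigma>: "term_ordering \<sigma>"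
    and lt: "\<And>i. i < length Z \<Longrightarrow> F ! i \<noteq> 0 \<and> leading_term \<sigma> (F ! i) = pp_indet (Z ! i)"
    unfolding separating_tuple_def by blast
  have tr: "trans \<sigma>" and anti: "antisym \<sigma>" and refl: "refl \<sigma>"
    using \<sigma> by (auto simp: term_ordering_def order_on_defs)
  define A where "A = {p. \<exists>q. avoids (set Z) q \<and> p - q \<in> I}"
  have A_avoids: "p \<in> A" if "avoids (set Z) p" for p
    unfolding A_def using that ring_mod.subspace_0[OF I] by (auto intro!: exI[of _ p])
  have A_add: "p + p' \<in> A" if pp': "p \<in> A" "p' \<in> A" for p p'
  proof -
    obtain q q' where q: "avoids (set Z) q" "p - q \<in> I" "avoids (set Z) q'" "p' - q' \<in> I"
      using pp' unfolding A_def by blast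
    have "(p + p') - (q + q') = (p - q) + (p' - q')" by simp
    then have "(p + p') - (q + q') \<in> I" using q ring_mod.subspace_add[OF I] by metis
    with q show ?thesis unfolding A_def using avoids_add by blast
  qed
  have A_mult: "p * p' \<in> A" if pp': "p \<in> A" "p' \<in> A" for p p'
  proof -
    obtain q q' where q: "avoids (set Z) q" "p - q \<in> I" "avoids (set Z) q'" "p' - q' \<in> I"
      using pp' unfolding A_def by blast
    have "p * p' - q * q' = p' * (p - q) + q * (p' - q')" by (simp add: algebra_simps)
    then have "p * p' - q * q' \<in> I"
      using q ring_mod.subspace_add[OF I] ring_mod.subspace_scale[OF I] by metis
    with q show ?thesis unfolding A_def using avoids_mult by blast
  qed
  have A_sum: "sum g T \<in> A" if "\<And>t. t \<in> T \<Longrightarrow> g t \<in> A" for g and T :: "'v power_product set"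
    using that
    by (induction T rule: infinite_finite_induct) (auto intro: A_add A_avoids simp: avoids_def)
  have Z_A: "z \<in> set Z \<Longrightarrow> indet z \<in> A" for z
  \<comment> \<open>The measure counts the elements of \<open>Z\<close> that are at most
    \<open>z\<close>. It drops from \<open>z\<close> to any smaller \<open>y\<close> in
    \<open>Z\<close>, because \<open>z\<close> itself is no longer counted.\<close>
  proof (induction "card {y \<in> set Z. (pp_indet y, pp_indet z) \<in> \<sigma>}" arbitrary: z rule: less_induct)
    case less
    obtain i where i: "i < length Z" "z = Z ! i"
      using less.prems by (metis in_set_conv_nth)
    define f where "f = F ! i"
    have f: "f \<in> I" "f \<noteq> 0" "leading_term \<sigma> f = pp_indet z"
      using assms(2) Z(2) lt i unfolding f_def by auto
    have z_key: "pp_indet z \<in> Poly_Mapping.keys f"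
      and z_max: "\<And>s. s \<in> Poly_Mapping.keys f \<Longrightarrow> (s, pp_indet z) \<in> \<sigma>"
      using leading_term_props[OF \<sigma> f(2)] f(3) by auto
    define c where "c = Poly_Mapping.lookup f (pp_indet z)"
    have "c \<noteq> 0" using z_key by (simp add: c_def in_keys_iff)
    define g where "g = (\<Sum>t\<in>Poly_Mapping.keys f - {pp_indet z}.
        Poly_Mapping.single t (Poly_Mapping.lookup f t))"
    have "f = Poly_Mapping.single (pp_indet z) c + g"
      using poly_mapping_eq_sum_single[of f] z_key
      unfolding g_def c_def by (simp add: sum.remove)
    then have f_eq: "f = Poly_Mapping.single 0 c * indet z + g"
      by (simp add: indet_def mult_single)
    have "g \<in> A"
      unfolding g_def
    proof (rule A_sum)
      fix t assume t: "t \<in> Poly_Mapping.keys f - {pp_indet z}"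
      show "Poly_Mapping.single t (Poly_Mapping.lookup f t) \<in> A"
      proof (rule subalgebra_single[OF A_avoids[OF avoids_single_0] A_mult])
        fix y assume y: "Poly_Mapping.lookup t y \<noteq> 0"
        show "indet y \<in> A"
        proof (cases "y \<in> set Z")
          case False
          then show ?thesis by (simp add: A_avoids avoids_indet)
        next
          case True
          from y obtain u where u: "t = pp_indet y + u"
            by (metis pp_dvd_pp_indet_iff pp_dvd_def)
          \<comment> \<open>A divisor of \<open>t\<close> is at most \<open>t\<close>: translate
            \<open>0 \<le> u\<close> by \<open>y\<close>.\<close>
          have "(0 + pp_indet y, u + pp_indet y) \<in> \<sigma>"
            using \<sigma> unfolding term_ordering_def by blast
          then have yt: "(pp_indet y, t) \<in> \<sigma>" by (simp add: u add.commute)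
          have tz: "(t, pp_indet z) \<in> \<sigma>" "t \<noteq> pp_indet z" using t z_max by auto
          have yz: "(pp_indet y, pp_indet z) \<in> \<sigma>" using yt tz tr by (blast dest: transD)
          \<comment> \<open>For \<open>y = z\<close> the inequalities \<open>z \<le> t\<close> and
            \<open>t \<le> z\<close> would force \<open>t = z\<close>, but this term was removed
            from \<open>g\<close>.\<close>
          have "y \<noteq> z" using yt tz anti by (auto dest: antisymD)
          then have "(pp_indet z, pp_indet y) \<notin> \<sigma>"
            using yz anti by (auto dest: antisymD)
          then have "{x \<in> set Z. (pp_indet x, pp_indet y) \<in> \<sigma>} \<subset> {x \<in> set Z. (pp_indet x, pp_indet z) \<in> \<sigma>}"
            using yz tr refl less.prems by (auto dest: transD simp: refl_on_def)
          then have "card {x \<in> set Z. (pp_indet x, pp_indet y) \<in> \<sigma>}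
              < card {x \<in> set Z. (pp_indet x, pp_indet z) \<in> \<sigma>}"
            by (intro psubset_card_mono) auto
          then show ?thesis using less.hyps True by blast
        qed
      qed
    qed
    then obtain q where q: "avoids (set Z) q" "g - q \<in> I"
      unfolding A_def by blast
    \<comment> \<open>The leading coefficient \<open>c\<close> may differ from 1. Modulo
      \<open>I\<close>, \<open>g\<close> can be replaced by \<open>q\<close>, so
      \<open>c z + q\<close> lies in \<open>I\<close>; division by \<open>c\<close> gives the
      required form with \<open>h = - q / c\<close>.\<close>
    let ?c' = "Poly_Mapping.single 0 (inverse c) :: ('v, 'k) mpoly"
    have "?c' * Poly_Mapping.single 0 c = 1"
      using \<open>c \<noteq> 0\<close> by (simp add: mult_single)
    then have "?c' * (Poly_Mapping.single 0 c * indet z) = indet z"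
      by (metis mult.assoc mult_1)
    moreover have "f - (g - q) = Poly_Mapping.single 0 c * indet z + q"
      unfolding f_eq by simp
    ultimately have "indet z - (- (?c' * q)) = ?c' * (f - (g - q))"
      by (simp only: distrib_left diff_minus_eq_add)
    then have "indet z - (- (?c' * q)) \<in> I"
      using f q ring_mod.subspace_diff[OF I] ring_mod.subspace_scale[OF I] by metis
    moreover have "avoids (set Z) (- (?c' * q))"
      by (intro avoids_uminus avoids_mult avoids_single_0 q)
    ultimately show ?case unfolding A_def by blast
  qed
  then have "\<forall>z\<in>set Z. \<exists>h. indet z - h \<in> I \<and> avoids (set Z) h"
    unfolding A_def by blast
  then show ?thesis using Z(1) by (simp add: admits_coherent_iff)
qed

section \<open>Linear terms in an ideal generated in degree \<open>d\<close>\<close>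

lemma ideal_lookup_pp_indet:
  fixes gs :: "('v::finite, 'k::field) mpoly set"
  assumes "\<forall>g\<in>gs. g \<in> hom_part W d" "d \<noteq> 0" "f \<in> ring_mod.span gs" "W x \<noteq> d"
  shows "Poly_Mapping.lookup f (pp_indet x) = 0"
proof -
  \<comment> \<open>Excluding the constant term as well makes \<open>?J\<close> an ideal: a term
    \<open>1\<close> or \<open>x\<close> of \<open>p * f\<close> needs a factor \<open>1\<close> or
    \<open>x\<close> among the terms of \<open>f\<close>. The generators lie in \<open>?J\<close>
    since \<open>1\<close> has degree 0 and \<open>x\<close> has degree \<open>W x\<close>, both
    different from \<open>d\<close>.\<close>
  let ?J = "{f :: ('v, 'k) mpoly. 0 \<notin> Poly_Mapping.keys f \<and> pp_indet x \<notin> Poly_Mapping.keys f}"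
  have "p * f \<in> ?J" if "f \<in> ?J" for p f
  proof -
    have "t \<notin> Poly_Mapping.keys (p * f)" if "t = 0 \<or> t = pp_indet x" for t
    proof
      assume "t \<in> Poly_Mapping.keys (p * f)"
      then obtain a b where ab: "t = a + b" "b \<in> Poly_Mapping.keys f"
        using keys_mult[of p f] by blast
      have "b = 0 \<or> b = pp_indet x"
      proof (cases "t = 0")
        case True
        have "b = 0"
        proof (rule poly_mapping_eqI)
          fix y
          have "Poly_Mapping.lookup (a + b) y = 0" using ab True by simp
          then show "Poly_Mapping.lookup b y = Poly_Mapping.lookup 0 y" by (simp add: lookup_add)
        qed
        then show ?thesis ..
      next
        case False
        then have "a + b = pp_indet x" using \<open>t = 0 \<or> t = pp_indet x\<close> ab by simp
        then show ?thesis by (rule add_eq_pp_indetE) auto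
      qed
      with ab \<open>f \<in> ?J\<close> show False by auto
    qed
    then show ?thesis by blast
  qed
  moreover have "f + g \<in> ?J" if "f \<in> ?J" "g \<in> ?J" for f g
    using that keys_add[of f g] by blast
  ultimately have "ring_mod.subspace ?J"
    unfolding ring_mod.subspace_def by (metis (lifting) empty_iff keys_zero mem_Collect_eq)
  moreover have "gs \<subseteq> ?J"
    using assms unfolding hom_part_def by force
  ultimately have "f \<in> ?J" using assms(3) ring_mod.span_minimal by blast
  then show ?thesis by (simp add: in_keys_iff)
qed

section \<open>Top rank\<close>

text \<open>The linear forms \<open>p\<close> are dual to the coordinates in \<open>Z\<close>:
  evaluating a linear relation between the columns at the \<open>p\<close> belonging to
  \<open>z\<close> isolates the coefficient at \<open>z\<close>. Hence the columns are independent,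
  whatever spanning list is chosen.\<close>

lemma top_rankI:
  fixes I :: "('v::finite, 'k::field) mpoly set"
  assumes "distinct Z"
    and dual: "\<And>z. z \<in> set Z \<Longrightarrow> \<exists>p\<in>lin_space I.
      \<forall>y\<in>set Z. Poly_Mapping.lookup p (pp_indet y) = (if y = z then 1 else 0)"
  shows "top_rank I Z"
  unfolding top_rank_def
proof (intro allI impI)
  fix ls :: "('v, 'k) mpoly list"
  assume ls: "poly_vs.span (set ls) = lin_space I"
  let ?s = "length Z"
  define A where "A = coeff_columns ls Z"
  have A: "A \<in> carrier_mat (length ls) ?s"
    by (simp add: A_def coeff_columns_def)
  have A_nth: "A $$ (k, j) = Poly_Mapping.lookup (ls ! k) (pp_indet (Z ! j))"
    if "k < length ls" "j < ?s" for k j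
    using that by (simp add: A_def coeff_columns_def)
  \<comment> \<open>A linear relation between the columns holds on \<open>ls\<close>, hence on all of \<open>lin_space I\<close>.\<close>
  have ker: "v i = 0"
    if v: "\<And>k. k < length ls \<Longrightarrow> (\<Sum>j<?s. A $$ (k, j) * v j) = 0" and i: "i < ?s"
    for v :: "nat \<Rightarrow> 'k" and i
  proof -
    let ?U = "{p :: ('v, 'k) mpoly. (\<Sum>j<?s. Poly_Mapping.lookup p (pp_indet (Z ! j)) * v j) = 0}"
    have scale: "Poly_Mapping.lookup (poly_scale c p) t = c * Poly_Mapping.lookup p t"
      for c and p :: "('v, 'k) mpoly" and t
      unfolding poly_scale_def mult_map_scale_conv_mult[symmetric]
      by (simp add: Poly_Mapping.map.rep_eq when_def)
    have "poly_vs.subspace ?U"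
      unfolding poly_vs.subspace_def mem_Collect_eq scale lookup_add distrib_right sum.distrib
        mult.assoc sum_distrib_left[symmetric]
      by simp
    moreover have "set ls \<subseteq> ?U"
    proof
      fix l assume "l \<in> set ls"
      then obtain k where "k < length ls" "l = ls ! k" by (metis in_set_conv_nth)
      with v[of k] show "l \<in> ?U" by (simp add: A_nth)
    qed
    ultimately have U: "lin_space I \<subseteq> ?U"
      unfolding ls[symmetric] by (intro poly_vs.span_minimal)
    obtain p where p: "p \<in> lin_space I"
      "\<forall>y\<in>set Z. Poly_Mapping.lookup p (pp_indet y) = (if y = Z ! i then 1 else 0)"
      using dual i by (meson nth_mem)
    have "(\<Sum>j<?s. Poly_Mapping.lookup p (pp_indet (Z ! j)) * v j)
        = (\<Sum>j<?s. if i = j then v j else 0)"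
      using p(2) i \<open>distinct Z\<close> by (intro sum.cong) (auto simp: nth_eq_iff_index_eq)
    also have "\<dots> = v i" using i by simp
    finally show ?thesis using U p(1) by auto
  qed
  \<comment> \<open>The rank criterion speaks about the set of columns, so repetitions must be
    excluded first. Equal columns \<open>i\<close> and \<open>j\<close> would give the relation with
    coefficients 1 and -1, contradicting \<open>ker\<close>.\<close>
  have cols: "distinct (cols A)"
    unfolding distinct_conv_nth
  proof (intro allI impI notI)
    fix i j assume ij: "i < length (cols A)" "j < length (cols A)" "i \<noteq> j" "cols A ! i = cols A ! j"
    then have ij': "i < ?s" "j < ?s" "col A i = col A j" using A by auto
    define v :: "nat \<Rightarrow> 'k" where "v l = (if l = i then 1 else 0) - (if l = j then 1 else 0)" for l
    have "(\<Sum>l<?s. A $$ (k, l) * v l) = 0" if k: "k < length ls" for k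
    proof -
      have "(\<Sum>l<?s. A $$ (k, l) * v l)
          = (\<Sum>l<?s. (if l = i then A $$ (k, l) else 0) - (if l = j then A $$ (k, l) else 0))"
        by (intro sum.cong) (auto simp: v_def)
      also have "\<dots> = A $$ (k, i) - A $$ (k, j)"
        using ij' by (simp add: sum_subtractf)
      also have "\<dots> = 0"
        using A ij' k by (metis carrier_matD diff_self index_col)
      finally show ?thesis .
    qed
    from ker[OF this ij'(1)] ij(3) show False by (simp add: v_def)
  qed
  interpret vec_space "TYPE('k)" "length ls" .
  have "lin_indpt (set (cols A))"
  proof (rule ccontr)
    assume "\<not> lin_indpt (set (cols A))"
    then obtain v where v: "v \<in> carrier_vec ?s" "v \<noteq> 0\<^sub>v ?s" "A *\<^sub>v v = 0\<^sub>v (length ls)"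
      using lin_depE[OF A _ cols] by blast
    have "(\<Sum>j<?s. A $$ (k, j) * (v $ j)) = 0" if "k < length ls" for k
    proof -
      have "(A *\<^sub>v v) $ k = (\<Sum>j<?s. A $$ (k, j) * (v $ j))"
        using A v(1) that by (simp add: scalar_prod_def lessThan_atLeast0)
      with v(3) that show ?thesis by simp
    qed
    from ker[OF this] v(1,2) show False by auto
  qed
  then show "rank A = ?s" using lin_indpt_full_rank[OF A cols] by blast
qed

lemma admits_coherent_top_rank:
  fixes I :: "('v::finite, 'k::field) mpoly set"
  assumes "admits_coherent I Z"
  shows "top_rank I Z"
proof (rule top_rankI)
  show "distinct Z" using assms by (simp add: admits_coherent_iff)
  fix z assume z: "z \<in> set Z"
  then obtain h where h: "indet z - h \<in> I" "avoids (set Z) h"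
    using assms unfolding admits_coherent_iff by blast
  have "lin_part (indet z - h) \<in> lin_space I"
    unfolding lin_space_def using h(1) by (simp add: poly_vs.span_base)
  moreover have "Poly_Mapping.lookup (lin_part (indet z - h)) (pp_indet y) = (if y = z then 1 else 0)"
    if "y \<in> set Z" for y
    using that h(2)
    by (auto simp: lin_part_def lookup_hom_component lookup_minus lookup_indet avoids_lookup_pp_indet)
  ultimately show "\<exists>p\<in>lin_space I.
      \<forall>y\<in>set Z. Poly_Mapping.lookup p (pp_indet y) = (if y = z then 1 else 0)" by blast
qed

section \<open>Homogeneous separating tuples and the acceptance test\<close>

text \<open>The component of degree \<open>W z\<close> of \<open>z - h\<close> keeps
  \<open>z\<close> and only part of \<open>h\<close>, so it is still \<open>z\<close> minus a
  polynomial avoiding \<open>Z\<close>. A single elimination ordering for the set of entries of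
  \<open>Z\<close> then serves all of them simultaneously.\<close>

lemma admits_coherent_homogeneous:
  fixes I :: "('v::finite, 'k::field) mpoly set"
  assumes "homogeneous_ideal W I" "admits_coherent I Z"
  shows "\<exists>F. homogeneous_separating_in W I Z F"
proof -
  have "\<forall>z\<in>set Z. \<exists>h. indet z - h \<in> I \<and> avoids (set Z) h"
    using assms(2) unfolding admits_coherent_iff ..
  then obtain h where h: "\<And>z. z \<in> set Z \<Longrightarrow> indet z - h z \<in> I \<and> avoids (set Z) (h z)"
    by metis
  obtain \<sigma> where \<sigma>: "term_ordering \<sigma>"
    and elim: "\<And>z t. z \<in> set Z \<Longrightarrow> \<forall>y\<in>set Z. Poly_Mapping.lookup t y = 0 \<Longrightarrow> (t, pp_indet z) \<in> \<sigma>"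
    using elimination_term_ordering by blast
  define f where "f z = hom_component W (W z) (indet z - h z)" for z
  have fI: "f z \<in> I" if "z \<in> set Z" for z
    using assms(1) h[OF that] unfolding homogeneous_ideal_def f_def by blast
  have fhom: "homogeneous W (f z)" for z
    unfolding homogeneous_def f_def using hom_component_in_hom_part by blast
  have lt: "f z \<noteq> 0 \<and> leading_term \<sigma> (f z) = pp_indet z" if z: "z \<in> set Z" for z
  proof -
    have f_eq: "f z = indet z - hom_component W (W z) (h z)"
      unfolding f_def by (rule hom_component_indet_diff)
    have av: "avoids (set Z) (hom_component W (W z) (h z))"
      using h[OF z] avoids_hom_component by blast
    have "Poly_Mapping.lookup (f z) (pp_indet z) = 1"
      using avoids_lookup_pp_indet[OF av z] by (simp add: f_eq lookup_minus lookup_indet)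
    then have key: "pp_indet z \<in> Poly_Mapping.keys (f z)" by (simp add: in_keys_iff)
    have "leading_term \<sigma> (f z) = pp_indet z"
    proof (rule leading_term_eqI[OF \<sigma> key])
      fix s assume "s \<in> Poly_Mapping.keys (f z)"
      then have "s = pp_indet z \<or> s \<in> Poly_Mapping.keys (hom_component W (W z) (h z))"
        by (auto simp: f_eq in_keys_iff lookup_minus lookup_indet split: if_splits)
      then show "(s, pp_indet z) \<in> \<sigma>"
        using elim[OF z] av \<sigma>
        by (auto simp: avoids_def term_ordering_def order_on_defs refl_on_def)
    qed
    with key show ?thesis by auto
  qed
  have "separating_tuple Z (map f Z)"
    unfolding separating_tuple_def
    using \<sigma> lt assms(2) by (auto simp: admits_coherent_iff)
  then have "homogeneous_separating_in W I Z (map f Z)"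
    using fI fhom by (auto simp: homogeneous_separating_in_def)
  then show ?thesis ..
qed

lemma accepts_iff_admits_coherent:
  fixes I :: "('v::finite, 'k::field) mpoly set"
  assumes "homogeneous_ideal W I"
  shows "accepts W I Z \<longleftrightarrow> admits_coherent I Z"
  using assms admits_coherent_top_rank admits_coherent_homogeneous[OF assms]
    separating_imp_admits_coherent
  unfolding accepts_def homogeneous_separating_in_def homogeneous_ideal_def by metis

text \<open>This bounds the length of every competitor by the size of \<open>S\<close> and places it
  among the candidates, even when its separating polynomials are inhomogeneous. The coefficient 1 of
  \<open>z\<close> in \<open>z - h\<close> forces \<open>W z = d\<close>.\<close>

lemma admits_coherent_subset_separating_indets:
  fixes gs :: "('v::finite, 'k::field) mpoly set"
  assumes "\<forall>g\<in>gs. g \<in> hom_part W d" "d \<noteq> 0" "admits_coherent (ring_mod.span gs) Z"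
  shows "set Z \<subseteq> separating_indets W d (ring_mod.span gs)"
proof
  fix z assume z: "z \<in> set Z"
  then obtain h where h: "indet z - h \<in> ring_mod.span gs" "avoids (set Z) h"
    using assms(3) unfolding admits_coherent_iff by blast
  have "Poly_Mapping.lookup (indet z - h) (pp_indet z) = 1"
    using avoids_lookup_pp_indet[OF h(2) z] by (simp add: lookup_minus lookup_indet)
  then have "W z = d"
    using ideal_lookup_pp_indet[OF assms(1,2) h(1)] by fastforce
  moreover have "separating_poly z (indet z - h)"
    using h(2) z by (auto simp: separating_poly_iff_avoids avoids_def)
  ultimately show "z \<in> separating_indets W d (ring_mod.span gs)"
    using h(1) by (auto simp: separating_indets_def)
qed

section \<open>The top-down search\<close>

lemma find_append:
  "find P (xs @ ys) = (case find P xs of None \<Rightarrow> find P ys | Some x \<Rightarrow> Some x)"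
  by (induction xs) auto

text \<open>The sizes decrease, so an accepted candidate of size \<open>k\<close> guarantees a hit
  no later than size \<open>k\<close>, hence of size at least \<open>k\<close>. The induction on
  \<open>m\<close> starts at \<open>k\<close> and prepends one block of larger candidates at a
  time.\<close>

lemma top_down_search_finds:
  assumes len: "\<And>k Z. Z \<in> set (cand k) \<Longrightarrow> length Z = k"
    and ex: "1 \<le> k" "k \<le> m" "Z \<in> set (cand k)" "acc Z"
  shows "\<exists>Z'. top_down_search acc cand m = Some Z' \<and> acc Z' \<and> Z' \<in> set (cand (length Z')) \<and>
           k \<le> length Z' \<and> length Z' \<le> m"
  using ex(2)
proof (induction m rule: dec_induct)
  case base
  have "find acc (cand k) \<noteq> None"
    using ex by (auto simp: find_None_iff)
  then obtain Z' where Z': "find acc (cand k) = Some Z'" by blast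
  then have "Z' \<in> set (cand k)" "acc Z'"
    by (auto simp: find_Some_iff)
  \<comment> \<open>Only for \<open>1 \<le> k\<close> is \<open>cand k\<close> the first block of
    the search from \<open>k\<close>, since the sizes stop at 1.\<close>
  then show ?case
    using Z' len ex(1)
    by (auto simp: top_down_search_def find_append)
next
  case (step n)
  have "rev [1..<Suc (Suc n)] = Suc n # rev [1..<Suc n]" by simp
  then have split: "top_down_search acc cand (Suc n) =
      (case find acc (cand (Suc n)) of None \<Rightarrow> top_down_search acc cand n | Some x \<Rightarrow> Some x)"
    unfolding top_down_search_def by (simp only: list.map concat.simps find_append)
  show ?case
  proof (cases "find acc (cand (Suc n))")
    case None
    with split step.IH show ?thesis by auto
  next
    case (Some Z')
    then have "Z' \<in> set (cand (Suc n))" "acc Z'"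
      by (auto simp: find_Some_iff)
    with Some split len step.hyps show ?thesis by auto
  qed
qed

section \<open>Success of the search and maximality of its result\<close>

text \<open>\<open>poly_vs.dim\<close> is the cardinality of a basis, which is 0 for an infinite
  basis too. The finite spanning list rules that case out, so the basis is empty.\<close>

lemma lin_space_dim_eq_0:
  fixes I :: "('v::finite, 'k::field) mpoly set"
  assumes "poly_vs.dim (lin_space I) = 0"
  shows "lin_space I \<subseteq> {0}"
proof -
  obtain ls :: "('v, 'k) mpoly list" where ls: "poly_vs.span (set ls) = lin_space I"
    using lin_space_spanning_list by blast
  obtain B where B: "B \<subseteq> lin_space I" "poly_vs.independent B" "lin_space I \<subseteq> poly_vs.span B"
      "card B = poly_vs.dim (lin_space I)"
    using poly_vs.basis_exists by blast
  have "finite B"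
    using poly_vs.independent_span_bound[of "set ls" B] B ls by simp
  with B(3,4) assms show ?thesis by simp
qed

theorem mainTheorem5:
  fixes W :: "'v::finite \<Rightarrow> int"
    and d :: int
    and I :: "('v, 'k::field) mpoly set"
    and gs :: "('v, 'k) mpoly list"
    and S :: "'v set"
    and m :: nat
    and cand :: "nat \<Rightarrow> 'v list list"
  assumes "\<forall>x. 0 \<le> W x"
    and "1 \<le> d"
    and "homogeneous_ideal W I"
    and "I \<inter> hom_part W 0 = {0}"
    and "I = ring_mod.span (set gs)"
    and "\<forall>g\<in>set gs. g \<in> hom_part W d"
    and "S = separating_indets W d I"
    and "S \<noteq> {}"
    and "m = min (card S) (poly_vs.dim (lin_space I))"
    and "enumerates_subsets S cand"
  shows "\<exists>Z. top_down_search (accepts W I) cand m = Some Z \<and>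
             best_tuple I Z \<and>
             (\<forall>z\<in>set Z. pp_deg W (pp_indet z) = d) \<and>
             (\<exists>F. homogeneous_separating_in W I Z F)"
proof -
  note I_hom = assms(3) and I_span = assms(5)
  have d: "d \<noteq> 0" using assms(2) by simp
  have acc: "accepts W I Z \<longleftrightarrow> admits_coherent I Z" for Z
    by (rule accepts_iff_admits_coherent[OF I_hom])
  have sub_S: "set Z \<subseteq> S" if "admits_coherent I Z" for Z
    using admits_coherent_subset_separating_indets[OF assms(6) d] that I_span assms(7) by simp
  have cand: "distinct Z \<and> set Z \<subseteq> S \<and> length Z = k" if "Z \<in> set (cand k)" for k Z
  proof -
    have "distinct Z" "set Z \<in> {S'. S' \<subseteq> S \<and> card S' = k}"
      using that assms(10) unfolding enumerates_subsets_def by (blast, metis imageI)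
    then show ?thesis by (auto simp: distinct_card)
  qed
  \<comment> \<open>Each nonempty competitor within the dimension bound forces the search to return
    a tuple at least as long.\<close>
  have found: "\<exists>Z'. top_down_search (accepts W I) cand m = Some Z' \<and> admits_coherent I Z' \<and>
      length Z \<le> length Z' \<and> length Z' \<le> m"
    if Z: "admits_coherent I Z" "Z \<noteq> []" "length Z \<le> poly_vs.dim (lin_space I)" for Z
  proof -
    have dist: "distinct Z" using Z(1) by (simp add: admits_coherent_iff)
    have card: "card (set Z) = length Z" using dist by (rule distinct_card)
    have "length Z \<le> card S"
      using card_mono[OF _ sub_S[OF Z(1)]] card by simp
    then have le: "length Z \<le> m" using Z(3) assms(9) by simp
    have "set Z \<in> set ` set (cand (length Z))"
      using assms(10) sub_S[OF Z(1)] card unfolding enumerates_subsets_def by simp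
    \<comment> \<open>The enumeration may list the entries of \<open>Z\<close> in another order
      \<open>Z0\<close>, which is coherent along with \<open>Z\<close>.\<close>
    then obtain Z0 where Z0: "Z0 \<in> set (cand (length Z))" "set Z0 = set Z" by auto
    then have "accepts W I Z0"
      using cand admits_coherent_cong_set[OF Z(1)] acc by blast
    moreover have "1 \<le> length Z" using Z(2) by (cases Z) auto
    ultimately show ?thesis
      using top_down_search_finds[of cand "length Z" m Z0 "accepts W I"] cand Z0(1) le acc by blast
  qed
  \<comment> \<open>An element of \<open>S\<close> yields a competitor of length 1, so the search
    can be shown to succeed.\<close>
  obtain z f where z: "f \<in> I" "separating_poly z f"
    using assms(7,8) by (auto simp: separating_indets_def)
  then have coh: "admits_coherent I [z]"
    by (auto simp: admits_coherent_iff separating_poly_iff_avoids)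
  obtain h where h: "f = indet z - h" "avoids {z} h"
    using z(2) unfolding separating_poly_iff_avoids by blast
  \<comment> \<open>The nonzero linear part of \<open>f\<close> makes the dimension at least 1, as
    \<open>found\<close> requires for \<open>[z]\<close>.\<close>
  have "Poly_Mapping.lookup (lin_part f) (pp_indet z) = 1"
    using avoids_lookup_pp_indet[OF h(2)]
    by (simp add: h(1) lin_part_def lookup_hom_component lookup_minus lookup_indet)
  moreover have "lin_part f \<in> lin_space I"
    unfolding lin_space_def using z(1) by (simp add: poly_vs.span_base)
  ultimately have "\<not> lin_space I \<subseteq> {0}" by force
  then have "1 \<le> poly_vs.dim (lin_space I)"
    using lin_space_dim_eq_0[of I] by fastforce
  then obtain Z where Z: "top_down_search (accepts W I) cand m = Some Z" "admits_coherent I Z"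
      "length Z \<le> m"
    using found[OF coh] by auto
  have "length Z = (GREATEST s. s \<le> poly_vs.dim (lin_space I) \<and>
      (\<exists>Z'. length Z' = s \<and> admits_coherent I Z'))"
  proof (rule Greatest_equality[symmetric])
    show "length Z \<le> poly_vs.dim (lin_space I) \<and> (\<exists>Z'. length Z' = length Z \<and> admits_coherent I Z')"
      using Z assms(9) by auto
  next
    fix s assume "s \<le> poly_vs.dim (lin_space I) \<and> (\<exists>Z'. length Z' = s \<and> admits_coherent I Z')"
    then obtain Z' where Z': "length Z' = s" "admits_coherent I Z'" "s \<le> poly_vs.dim (lin_space I)"
      by blast
    show "s \<le> length Z"
    proof (cases "Z' = []")
      case True
      with Z' show ?thesis by simp
    next
      case False
      \<comment> \<open>The search has only one result, so the tuple that \<open>found\<close>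
        supplies for \<open>Z'\<close> is \<open>Z\<close> itself.\<close>
      with found[OF Z'(2)] Z' Z(1) show ?thesis by auto
    qed
  qed
  then have "best_tuple I Z"
    using Z(2) by (simp add: best_tuple_def)
  moreover have "\<forall>z\<in>set Z. pp_deg W (pp_indet z) = d"
    using sub_S[OF Z(2)] assms(7) by (auto simp: separating_indets_def)
  ultimately show ?thesis
    using Z(1,2) admits_coherent_homogeneous[OF I_hom] by blast
qed

end
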